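(* For integers $q,r\ge 2$, the grid graph $G=P_q\Box P_r$ satisfies $\kappa(G)=2q+2r-4$.
   Context: All graphs are finite, simple and connected; $d(u,v)$ is the shortest-path distance. $P_q\Box P_r$ is the Cartesian product of the paths on $q$ and $r$ vertices. For vertices $x,y,s$ put $\Delta_s(x,y)=|d(x,s)-d(y,s)|$ and for $S\subseteq V(G)$ put $\Delta_S(x,y)=\sum_{s\in S}\Delta_s(x,y)$. For an integer $k\ge1$, $S\subseteq V(G)$ is a weak $k$-resolving set if $\Delta_S(x,y)\ge k$ for every pair of distinct vertices $x,y$. $\kappa(G)$ is the largest $k$ such that $G$ has a weak $k$-resolving set. *)

theory Defs
  imports "Graph_Theory.Graph_Theory"
begin

text \<open>
  A finite simple graph is a \<^locale>\<open>pair_graph\<close>: a finite, loop-free digraph whose arcs are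
  ordered pairs of vertices and whose arc relation is symmetric. An undirected edge is thus a pair
  of opposite arcs.
\<close>

definition path_graph :: "nat \<Rightarrow> nat pair_pre_digraph" where
  "path_graph n =
    \<lparr> pverts = {0..<n},
      parcs = {(i, j). i < n \<and> j < n \<and> (j = Suc i \<or> i = Suc j)} \<rparr>"

definition cartesian_product ::
    "'a pair_pre_digraph \<Rightarrow> 'b pair_pre_digraph \<Rightarrow> ('a \<times> 'b) pair_pre_digraph" where
  "cartesian_product G H =
    \<lparr> pverts = pverts G \<times> pverts H,
      parcs = {((u, v), (u', v')).
        (u = u' \<and> u \<in> pverts G \<and> (v, v') \<in> parcs H) \<or>
        (v = v' \<and> v \<in> pverts H \<and> (u, u') \<in> parcs G)} \<rparr>"

text \<open>
  The least length of a walk is attained by a path. The infimum is that of the natural numbers, so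
  the value is meaningful only for vertices joined by some walk.
\<close>

definition graph_dist :: "'a pair_pre_digraph \<Rightarrow> 'a \<Rightarrow> 'a \<Rightarrow> nat" where
  "graph_dist G u v = (INF p\<in>{p. pre_digraph.awalk (with_proj G) u p v}. length p)"

definition delta :: "'a pair_pre_digraph \<Rightarrow> 'a \<Rightarrow> 'a \<Rightarrow> 'a \<Rightarrow> int" where
  "delta G s x y = \<bar>int (graph_dist G x s) - int (graph_dist G y s)\<bar>"

definition delta_set :: "'a pair_pre_digraph \<Rightarrow> 'a set \<Rightarrow> 'a \<Rightarrow> 'a \<Rightarrow> int" where
  "delta_set G S x y = (\<Sum>s\<in>S. delta G s x y)"

definition weak_resolving_set :: "'a pair_pre_digraph \<Rightarrow> nat \<Rightarrow> 'a set \<Rightarrow> bool" where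
  "weak_resolving_set G k S \<longleftrightarrow>
    S \<subseteq> pverts G \<and>
    (\<forall>x\<in>pverts G. \<forall>y\<in>pverts G. x \<noteq> y \<longrightarrow> delta_set G S x y \<ge> int k)"

text \<open>
  The maximum exists for every finite connected graph with at least two vertices; otherwise
  \<^const>\<open>Greatest\<close> is unspecified.
\<close>

definition kappa :: "'a pair_pre_digraph \<Rightarrow> nat" where
  "kappa G = (GREATEST k. 1 \<le> k \<and> (\<exists>S. weak_resolving_set G k S))"

lemma pair_graph_path_graph: "pair_graph (path_graph n)"
proof -
  have "parcs (path_graph n) \<subseteq> {0..<n} \<times> {0..<n}"
    by (auto simp: path_graph_def)
  then have "finite (parcs (path_graph n))"
    by (rule finite_subset) simp
  then show ?thesis
    by unfold_locales (auto simp: path_graph_def symmetric_def sym_def)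
qed

lemma pair_graph_cartesian_product:
  assumes "pair_graph G" "pair_graph H"
  shows "pair_graph (cartesian_product G H)"
proof -
  interpret G: pair_graph G by fact
  interpret H: pair_graph H by fact
  let ?P = "cartesian_product G H"
  have sub: "parcs ?P \<subseteq> pverts ?P \<times> pverts ?P"
    by (auto simp: cartesian_product_def dest: G.wellformed' H.wellformed')
  have fin: "finite (pverts ?P)"
    by (simp add: cartesian_product_def)
  have "finite (parcs ?P)"
    using sub by (rule finite_subset) (simp add: fin)
  moreover have "sym (parcs G)" "sym (parcs H)"
    using G.pair_sym_arcs H.pair_sym_arcs by (auto simp: symmetric_def)
  then have "sym (parcs ?P)"
    by (auto simp: cartesian_product_def sym_def)
  moreover have "fst e \<noteq> snd e" if "e \<in> parcs ?P" for e
    using that G.pair_no_loops H.pair_no_loops by (force simp: cartesian_product_def)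
  ultimately show ?thesis
    using sub fin by unfold_locales (auto simp: symmetric_def)
qed

lemma strongly_connected_path_graph:
  assumes "n \<ge> 1"
  shows "strongly_connected (with_proj (path_graph n))"
proof -
  interpret pair_graph "path_graph n" by (rule pair_graph_path_graph)
  have up: "0 \<rightarrow>\<^sup>*\<^bsub>with_proj (path_graph n)\<^esub> i" if "i < n" for i
    using that
  proof (induction i)
    case 0
    then have "0 \<in> pverts (path_graph n)" by (simp add: path_graph_def)
    then show ?case by simp
  next
    case (Suc i)
    then have "(i, Suc i) \<in> parcs (path_graph n)"
      by (simp add: path_graph_def)
    with Suc show ?case by (meson Suc_lessD reachable_adj_trans)
  qed
  show ?thesis
  proof (rule strongly_connectedI)
    show "verts (with_proj (path_graph n)) \<noteq> {}"
      using assms by (simp add: path_graph_def)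
  next
    fix i j
    assume "i \<in> verts (with_proj (path_graph n))" "j \<in> verts (with_proj (path_graph n))"
    then have "i < n" "j < n" by (auto simp: path_graph_def)
    moreover have "i \<rightarrow>\<^sup>*\<^bsub>with_proj (path_graph n)\<^esub> 0"
      using up[OF \<open>i < n\<close>] by (rule symmetric_reachable[OF sym_arcs])
    ultimately show "i \<rightarrow>\<^sup>*\<^bsub>with_proj (path_graph n)\<^esub> j"
      using up reachable_trans by blast
  qed
qed

lemma strongly_connected_cartesian_product:
  assumes "pair_graph G" "pair_graph H"
    and "strongly_connected (with_proj G)" "strongly_connected (with_proj H)"
  shows "strongly_connected (with_proj (cartesian_product G H))"
proof -
  interpret G: pair_graph G by fact
  interpret H: pair_graph H by fact
  let ?P = "with_proj (cartesian_product G H)"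
  interpret P: pair_graph "cartesian_product G H"
    by (rule pair_graph_cartesian_product) fact+
  have left: "(u, v) \<rightarrow>\<^sup>*\<^bsub>?P\<^esub> (u', v)"
    if "u \<rightarrow>\<^sup>*\<^bsub>with_proj G\<^esub> u'" "v \<in> pverts H" for u u' v
    using that
  proof (induction rule: G.reachable_induct)
    case base
    then have "(u, v) \<in> pverts (cartesian_product G H)"
      by (auto simp: cartesian_product_def dest: G.reachable_in_verts)
    then show ?case by simp
  next
    case (step x y)
    then have "((x, v), (y, v)) \<in> parcs (cartesian_product G H)" by (simp add: cartesian_product_def)
    with step show ?case by (meson P.reachable_adj_trans)
  qed
  have right: "(u, v) \<rightarrow>\<^sup>*\<^bsub>?P\<^esub> (u, v')"
    if "v \<rightarrow>\<^sup>*\<^bsub>with_proj H\<^esub> v'" "u \<in> pverts G" for u v v'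
    using that
  proof (induction rule: H.reachable_induct)
    case base
    then have "(u, v) \<in> pverts (cartesian_product G H)"
      by (auto simp: cartesian_product_def dest: H.reachable_in_verts)
    then show ?case by simp
  next
    case (step x y)
    then have "((u, x), (u, y)) \<in> parcs (cartesian_product G H)" by (simp add: cartesian_product_def)
    with step show ?case by (meson P.reachable_adj_trans)
  qed
  show ?thesis
  proof (rule strongly_connectedI)
    show "verts ?P \<noteq> {}"
      using assms(3,4) by (auto simp: strongly_connected_def cartesian_product_def)
  next
    fix a b
    assume "a \<in> verts ?P" "b \<in> verts ?P"
    then obtain u v u' v' where *: "a = (u, v)" "b = (u', v')"
      "u \<in> pverts G" "u' \<in> pverts G" "v \<in> pverts H" "v' \<in> pverts H"
      by (auto simp: cartesian_product_def)
    with assms(3,4) have "u \<rightarrow>\<^sup>*\<^bsub>with_proj G\<^esub> u'" "v \<rightarrow>\<^sup>*\<^bsub>with_proj H\<^esub> v'"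
      by (auto simp: strongly_connected_def)
    with * show "a \<rightarrow>\<^sup>*\<^bsub>?P\<^esub> b"
      using left right P.reachable_trans by metis
  qed
qed

lemma graph_dist_eq_mu:
  assumes "pair_graph G" "u \<rightarrow>\<^sup>*\<^bsub>with_proj G\<^esub> v"
  shows "wf_digraph.\<mu> (with_proj G) (\<lambda>_. 1) u v = ereal (real (graph_dist G u v))"
proof -
  interpret pair_graph G by fact
  have cost: "awalk_cost (\<lambda>_. 1) p = real (length p)" for p
    by (induction p) (auto simp: awalk_cost_def)
  have "{p. awalk u p v} \<noteq> {}"
    using assms(2) by (auto simp: reachable_awalk)
  then have "graph_dist G u v \<in> length ` {p. awalk u p v}"
    unfolding graph_dist_def by (intro Inf_nat_def1) simp
  then obtain p where p: "awalk u p v" "length p = graph_dist G u v"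
    by auto
  have le: "graph_dist G u v \<le> length p'" if "awalk u p' v" for p'
    unfolding graph_dist_def using that by (intro cINF_lower) auto
  show ?thesis
    unfolding \<mu>_def
  proof (rule antisym)
    show "(INF p\<in>{p. awalk u p v}. ereal (awalk_cost (\<lambda>_. 1) p)) \<le> ereal (real (graph_dist G u v))"
      using p by (intro INF_lower2[of p]) (auto simp: cost)
    show "ereal (real (graph_dist G u v)) \<le> (INF p\<in>{p. awalk u p v}. ereal (awalk_cost (\<lambda>_. 1) p))"
      by (intro INF_greatest) (auto simp: cost le)
  qed
qed

end

theory Submission
  imports Defs
begin

text \<open>
  Since \<open>\<Delta>\<^sub>S\<close> grows with \<open>S\<close>, only \<open>S = V\<close> matters. With \<open>x = (a, b)\<close> and
  \<open>y = (c, d)\<close> the difference of the distances to \<open>(i, j)\<close> is \<open>u i + v j\<close>, where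
  \<open>u i = \<bar>a - i\<bar> - \<bar>c - i\<bar>\<close> and \<open>v j = \<bar>b - j\<bar> - \<bar>d - j\<bar>\<close> take opposite values at the two ends
  of their ranges. If \<open>a \<noteq> c\<close> and \<open>b \<noteq> d\<close>, the boundary of the grid alone suffices: the four
  corners contribute at least \<open>4\<close>, and each pair of opposite non-corner boundary vertices
  contributes at least \<open>2\<close>. If \<open>x\<close> and \<open>y\<close> lie on a common row or column, the sum is at least
  \<open>q r \<ge> 2 q + 2 r - 4\<close>. The two neighbours of a corner attain the bound.
\<close>

abbreviation grid :: "nat \<Rightarrow> nat \<Rightarrow> (nat \<times> nat) pair_pre_digraph" where
  "grid q r \<equiv> cartesian_product (path_graph q) (path_graph r)"

text \<open>The l1 metric, shown below to be the distance in the grid. Integer values keep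
  \<open>taxicab x y - 1\<close> from being truncated at 0.\<close>

definition taxicab :: "nat \<times> nat \<Rightarrow> nat \<times> nat \<Rightarrow> int" where
  "taxicab x y = \<bar>int (fst x) - int (fst y)\<bar> + \<bar>int (snd x) - int (snd y)\<bar>"

lemma pverts_grid: "pverts (grid q r) = {0..<q} \<times> {0..<r}"
  by (simp add: cartesian_product_def path_graph_def)

lemma grid_awalk_length_ge:
  assumes "pre_digraph.awalk (with_proj (grid q r)) x p y"
  shows "taxicab x y \<le> int (length p)"
proof -
  interpret pair_graph "grid q r"
    by (intro pair_graph_cartesian_product pair_graph_path_graph)
  show ?thesis
    using assms
  proof (induction p arbitrary: x)
    case Nil
    then show ?case by (simp add: awalk_Nil_iff taxicab_def)
  next
    case (Cons e p)
    then have e: "e \<in> parcs (grid q r)" "x = fst e" and IH: "taxicab (snd e) y \<le> int (length p)"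
      by (auto simp: awalk_Cons_iff)
    \<comment> \<open>An arc changes exactly one coordinate, by one, so it brings the walk at most
      one unit closer to \<open>y\<close>.\<close>
    have "taxicab x y \<le> 1 + taxicab (snd e) y"
      using e by (auto simp: taxicab_def cartesian_product_def path_graph_def)
    with IH show ?case by simp
  qed
qed

text \<open>Move the first coordinate towards that of \<open>y\<close> while they differ, then the
  second; the move stays in the grid because it never passes \<open>y\<close>.\<close>

lemma grid_step_towards:
  assumes "x \<in> pverts (grid q r)" "y \<in> pverts (grid q r)" "x \<noteq> y"
  shows "\<exists>z. (x, z) \<in> parcs (grid q r) \<and> z \<in> pverts (grid q r) \<and> taxicab z y = taxicab x y - 1"
proof -
  obtain a b c d where xy: "x = (a, b)" "y = (c, d)" by (cases x, cases y)
  have bounds: "a < q" "b < r" "c < q" "d < r"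
    using assms xy by (auto simp: pverts_grid)
  consider "a < c" | "a > c" | "a = c" "b < d" | "a = c" "b > d"
    using assms(3) xy by force
  then show ?thesis
  proof cases
    case 1
    with bounds xy show ?thesis
      by (intro exI[of _ "(Suc a, b)"]) (auto simp: taxicab_def cartesian_product_def path_graph_def)
  next
    case 2
    with bounds xy show ?thesis
      by (intro exI[of _ "(a - 1, b)"]) (auto simp: taxicab_def cartesian_product_def path_graph_def)
  next
    case 3
    with bounds xy show ?thesis
      by (intro exI[of _ "(a, Suc b)"]) (auto simp: taxicab_def cartesian_product_def path_graph_def)
  next
    case 4
    with bounds xy show ?thesis
      by (intro exI[of _ "(a, b - 1)"]) (auto simp: taxicab_def cartesian_product_def path_graph_def)
  qed
qed

lemma grid_awalk_exists:
  assumes "x \<in> pverts (grid q r)" "y \<in> pverts (grid q r)"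
  shows "\<exists>p. pre_digraph.awalk (with_proj (grid q r)) x p y \<and> int (length p) = taxicab x y"
proof -
  interpret pair_graph "grid q r"
    by (intro pair_graph_cartesian_product pair_graph_path_graph)
  show ?thesis
    using assms
  proof (induction "nat (taxicab x y)" arbitrary: x)
    case 0
    then have "x = y" by (auto simp: taxicab_def prod_eq_iff)
    with 0 show ?case by (intro exI[of _ "[]"]) (simp add: awalk_Nil_iff taxicab_def)
  next
    case (Suc n)
    then have "x \<noteq> y" by (auto simp: taxicab_def)
    then obtain z where z: "(x, z) \<in> parcs (grid q r)" "z \<in> pverts (grid q r)"
        "taxicab z y = taxicab x y - 1"
      using grid_step_towards Suc.prems by blast
    moreover from this Suc.hyps(2) have "n = nat (taxicab z y)" by simp
    ultimately obtain p where "awalk z p y" "int (length p) = taxicab z y"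
      using Suc.hyps(1) Suc.prems(2) by blast
    with z show ?case by (intro exI[of _ "(x, z) # p"]) (simp add: awalk_Cons_iff)
  qed
qed

lemma graph_dist_grid:
  assumes "x \<in> pverts (grid q r)" "y \<in> pverts (grid q r)"
  shows "int (graph_dist (grid q r) x y) = taxicab x y"
proof -
  obtain p where p: "pre_digraph.awalk (with_proj (grid q r)) x p y" "int (length p) = taxicab x y"
    using grid_awalk_exists[OF assms] by blast
  have "(INF p\<in>{p. pre_digraph.awalk (with_proj (grid q r)) x p y}. length p) = length p"
  proof (rule cInf_eq_minimum)
    show "length p \<in> length ` {p. pre_digraph.awalk (with_proj (grid q r)) x p y}"
      using p by blast
    show "length p \<le> n" if n: "n \<in> length ` {p. pre_digraph.awalk (with_proj (grid q r)) x p y}" for n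
      using n grid_awalk_length_ge[of q r x _ y] p(2) by fastforce
  qed
  with p show ?thesis by (simp add: graph_dist_def)
qed

lemma delta_set_grid:
  assumes "(a, b) \<in> pverts (grid q r)" "(c, d) \<in> pverts (grid q r)"
  shows "delta_set (grid q r) (pverts (grid q r)) (a, b) (c, d) =
    (\<Sum>i = 0..<q. \<Sum>j = 0..<r. \<bar>(\<bar>int a - int i\<bar> - \<bar>int c - int i\<bar>) + (\<bar>int b - int j\<bar> - \<bar>int d - int j\<bar>)\<bar>)"
proof -
  have "delta_set (grid q r) (pverts (grid q r)) (a, b) (c, d) =
    (\<Sum>s\<in>{0..<q} \<times> {0..<r}. \<bar>taxicab (a, b) s - taxicab (c, d) s\<bar>)"
    unfolding delta_set_def delta_def pverts_grid[symmetric]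
    by (intro sum.cong refl) (simp add: graph_dist_grid assms)
  also have "\<dots> = (\<Sum>i = 0..<q. \<Sum>j = 0..<r. \<bar>taxicab (a, b) (i, j) - taxicab (c, d) (i, j)\<bar>)"
    by (simp add: sum.cartesian_product)
  finally show ?thesis
    by (simp add: taxicab_def algebra_simps)
qed

lemma delta_set_mono:
  assumes "finite T" "S \<subseteq> T"
  shows "delta_set G S x y \<le> delta_set G T x y"
  unfolding delta_set_def delta_def using assms by (intro sum_mono2) auto

text \<open>Isolates the two ends of a range, so that corners and other boundary vertices get
  separate bounds; \<open>c = 0\<close> discards the interior.\<close>

lemma sum_ge_ends:
  fixes h :: "nat \<Rightarrow> int"
  assumes "n \<ge> 2" and "\<And>i. \<lbrakk>0 < i; i < n - 1\<rbrakk> \<Longrightarrow> c \<le> h i"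
  shows "h 0 + h (n - 1) + (int n - 2) * c \<le> (\<Sum>i = 0..<n. h i)"
proof -
  obtain m where n: "n = Suc (Suc m)"
    using assms(1) by (metis One_nat_def Suc_1 Suc_le_D Suc_le_mono)
  have "(\<Sum>i = 0..<n. h i) = h 0 + (\<Sum>i = 0..<m. h (Suc i)) + h (n - 1)"
    unfolding n by (subst sum.atLeast0_lessThan_Suc, subst sum.atLeast0_lessThan_Suc_shift) simp
  moreover have "(\<Sum>i = 0..<m. c) \<le> (\<Sum>i = 0..<m. h (Suc i))"
    using assms(2) n by (intro sum_mono) auto
  ultimately show ?thesis using n by simp
qed

lemma sum_abs_add_ge:
  fixes u v :: "nat \<Rightarrow> int"
  assumes "q \<ge> 2" "r \<ge> 2"
    and u: "u (q - 1) = - u 0" "u 0 \<noteq> 0" and v: "v (r - 1) = - v 0" "v 0 \<noteq> 0"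
  shows "2 * int q + 2 * int r - 4 \<le> (\<Sum>i = 0..<q. \<Sum>j = 0..<r. \<bar>u i + v j\<bar>)"
proof -
  let ?h = "\<lambda>i. \<Sum>j = 0..<r. \<bar>u i + v j\<bar>"
  \<comment> \<open>With \<open>t = v 0\<close> the two end terms are \<open>|u i + t|\<close> and
    \<open>|u i - t|\<close>, whose sum is at least \<open>2 * |t|\<close>, and \<open>t\<close> is
    a nonzero integer.\<close>
  have interior: "2 \<le> ?h i" for i
  proof -
    have "\<bar>u i + v 0\<bar> + \<bar>u i + v (r - 1)\<bar> + (int r - 2) * 0 \<le> ?h i"
      by (rule sum_ge_ends) (use assms in auto)
    then show ?thesis using v by linarith
  qed
  \<comment> \<open>The lines \<open>i = 0\<close> and \<open>i = q - 1\<close> are added for each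
    \<open>j\<close>: opposite values of \<open>u\<close> give at least \<open>2 * |u 0|\<close>,
    hence 2. The four corner terms are kept exact; they total 4 times the maximum of
    \<open>|u 0|\<close> and \<open>|v 0|\<close>.\<close>
  have "(\<bar>u 0 + v 0\<bar> + \<bar>u (q - 1) + v 0\<bar>) + (\<bar>u 0 + v (r - 1)\<bar> + \<bar>u (q - 1) + v (r - 1)\<bar>)
      + (int r - 2) * 2 \<le> (\<Sum>j = 0..<r. \<bar>u 0 + v j\<bar> + \<bar>u (q - 1) + v j\<bar>)"
    by (rule sum_ge_ends) (use assms in auto)
  moreover have "?h 0 + ?h (q - 1) + (int q - 2) * 2 \<le> (\<Sum>i = 0..<q. ?h i)"
    by (rule sum_ge_ends) (use assms interior in auto)
  ultimately show ?thesis
    using u v by (simp add: sum.distrib)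
qed

text \<open>As \<open>a\<close> and \<open>c\<close> differ, a term vanishes only where
  \<open>2 * i = a + c\<close>. If \<open>a + c\<close> is even, then \<open>a\<close> and
  \<open>c\<close> differ by at least 2, which is the surplus available at
  \<open>i = 0\<close>.\<close>

lemma sum_abs_diff_ge:
  fixes a c q :: nat
  assumes "a < q" "c < q" "a \<noteq> c"
  shows "int q \<le> (\<Sum>i = 0..<q. \<bar>\<bar>int a - int i\<bar> - \<bar>int c - int i\<bar>\<bar>)"
proof (cases "even (a + c)")
  case False
  have "(\<Sum>i = 0..<q. 1) \<le> (\<Sum>i = 0..<q. \<bar>\<bar>int a - int i\<bar> - \<bar>int c - int i\<bar>\<bar>)"
  proof (rule sum_mono)
    fix i
    have "a + c \<noteq> 2 * i" using False by (metis dvd_triv_left)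
    then show "1 \<le> \<bar>\<bar>int a - int i\<bar> - \<bar>int c - int i\<bar>\<bar>" using assms(3) by linarith
  qed
  then show ?thesis by simp
next
  case True
  then obtain k where k: "a + c = 2 * k" by blast
  \<comment> \<open>the vanishing term at the midpoint \<open>k\<close> is compensated by the term at \<open>0\<close>\<close>
  have "(\<Sum>i = 0..<q. 1 + of_bool (i = 0) - of_bool (i = k)) \<le>
      (\<Sum>i = 0..<q. \<bar>\<bar>int a - int i\<bar> - \<bar>int c - int i\<bar>\<bar>)"
  proof (rule sum_mono)
    fix i
    show "1 + of_bool (i = 0) - of_bool (i = k) \<le> \<bar>\<bar>int a - int i\<bar> - \<bar>int c - int i\<bar>\<bar>"
      using assms(3) k by (cases "i = 0"; cases "i = k") (simp_all, arith+)
  qed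
  moreover have "k < q" "0 < q" using k assms by auto
  ultimately show ?thesis by (simp add: sum.distrib sum_subtractf of_bool_def)
qed

lemma mult_ge_twice_add:
  assumes "q \<ge> 2" "r \<ge> 2"
  shows "2 * int q + 2 * int r - 4 \<le> int q * int r"
proof -
  have "0 \<le> (int q - 2) * (int r - 2)" using assms by simp
  then show ?thesis by (simp add: algebra_simps)
qed

lemma delta_set_grid_ge:
  assumes "q \<ge> 2" "r \<ge> 2"
    and V: "x \<in> pverts (grid q r)" "y \<in> pverts (grid q r)" and "x \<noteq> y"
  shows "2 * int q + 2 * int r - 4 \<le> delta_set (grid q r) (pverts (grid q r)) x y"
proof -
  obtain a b c d where xy: "x = (a, b)" "y = (c, d)" by (cases x, cases y)
  have bounds: "a < q" "b < r" "c < q" "d < r"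
    using V xy by (auto simp: pverts_grid)
  define u where "u i = \<bar>int a - int i\<bar> - \<bar>int c - int i\<bar>" for i
  define v where "v j = \<bar>int b - int j\<bar> - \<bar>int d - int j\<bar>" for j
  have eq: "delta_set (grid q r) (pverts (grid q r)) x y = (\<Sum>i = 0..<q. \<Sum>j = 0..<r. \<bar>u i + v j\<bar>)"
    using V unfolding xy u_def v_def by (rule delta_set_grid)
  consider "a = c" "b \<noteq> d" | "a \<noteq> c" "b = d" | "a \<noteq> c" "b \<noteq> d"
    using xy \<open>x \<noteq> y\<close> by auto
  then show ?thesis
  proof cases
    case 1
    \<comment> \<open>Here \<open>u\<close> vanishes, so each of the \<open>q\<close> values of
      \<open>i\<close> contributes the same sum over \<open>j\<close>, which is at least
      \<open>r\<close>.\<close>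
    then have "int q * int r \<le> int q * (\<Sum>j = 0..<r. \<bar>v j\<bar>)"
      unfolding v_def using bounds by (intro mult_left_mono sum_abs_diff_ge) auto
    moreover have "u i = 0" for i using 1 by (simp add: u_def)
    ultimately show ?thesis
      using mult_ge_twice_add[OF assms(1,2)] eq by simp
  next
    case 2
    then have "int r * int q \<le> int r * (\<Sum>i = 0..<q. \<bar>u i\<bar>)"
      unfolding u_def using bounds by (intro mult_left_mono sum_abs_diff_ge) auto
    moreover have "v j = 0" for j using 2 by (simp add: v_def)
    ultimately show ?thesis
      using mult_ge_twice_add[OF assms(1,2)] eq by (simp add: sum_distrib_left mult.commute)
  next
    case 3
    \<comment> \<open>At the ends \<open>u 0 = a - c\<close> and \<open>u (q - 1) = c - a\<close>,
      since both \<open>a\<close> and \<open>c\<close> lie in the range; likewise for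
      \<open>v\<close>.\<close>
    then show ?thesis
      unfolding eq using bounds assms(1,2)
      by (intro sum_abs_add_ge) (auto simp: u_def v_def of_nat_diff)
  qed
qed

lemma delta_set_grid_corner:
  assumes "q \<ge> 2" "r \<ge> 2"
  shows "delta_set (grid q r) (pverts (grid q r)) (0, 1) (1, 0) = 2 * int q + 2 * int r - 4"
proof -
  obtain m n where mn: "q = Suc m" "r = Suc n"
    using assms by (metis Suc_le_D numeral_2_eq_2)
  have "delta_set (grid q r) (pverts (grid q r)) (0, 1) (1, 0) =
    (\<Sum>i = 0..<q. \<Sum>j = 0..<r. \<bar>(\<bar>int 0 - int i\<bar> - \<bar>int 1 - int i\<bar>) + (\<bar>int 1 - int j\<bar> - \<bar>int 0 - int j\<bar>)\<bar>)"
    using assms by (intro delta_set_grid) (auto simp: pverts_grid)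
  \<comment> \<open>Here \<open>u\<close> is -1 at 0 and 1 elsewhere, and \<open>v\<close> is its
    negative pattern. Hence a term is 2 when exactly one of \<open>i\<close>, \<open>j\<close> is 0,
    and 0 otherwise; peeling off index 0 exposes these \<open>m + n\<close> terms.\<close>
  also have "\<dots> = 2 * int m + 2 * int n"
    unfolding mn by (simp add: sum.atLeast0_lessThan_Suc_shift del: sum.op_ivl_Suc)
  finally show ?thesis using mn by simp
qed

theorem theorem3p2:
  fixes q r :: nat
  assumes "q \<ge> 2" and "r \<ge> 2"
  shows "kappa (cartesian_product (path_graph q) (path_graph r)) = 2 * q + 2 * r - 4"
  unfolding kappa_def
proof (rule Greatest_equality)
  have "weak_resolving_set (grid q r) (2 * q + 2 * r - 4) (pverts (grid q r))"
    using delta_set_grid_ge[OF assms] assms by (auto simp: weak_resolving_set_def of_nat_diff)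
  then show "1 \<le> 2 * q + 2 * r - 4 \<and> (\<exists>S. weak_resolving_set (grid q r) (2 * q + 2 * r - 4) S)"
    using assms by auto
next
  fix k
  assume "1 \<le> k \<and> (\<exists>S. weak_resolving_set (grid q r) k S)"
  then obtain S where S: "S \<subseteq> pverts (grid q r)"
    and res: "\<And>x y. \<lbrakk>x \<in> pverts (grid q r); y \<in> pverts (grid q r); x \<noteq> y\<rbrakk>
      \<Longrightarrow> int k \<le> delta_set (grid q r) S x y"
    by (auto simp: weak_resolving_set_def)
  \<comment> \<open>One pair suffices for the upper bound, and passing from \<open>S\<close> to all
    vertices makes the bound independent of \<open>S\<close>.\<close>
  have "int k \<le> delta_set (grid q r) S (0, 1) (1, 0)"
    using assms by (intro res) (auto simp: pverts_grid)
  also have "\<dots> \<le> delta_set (grid q r) (pverts (grid q r)) (0, 1) (1, 0)"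
    using S by (intro delta_set_mono) (simp_all add: pverts_grid)
  also have "\<dots> = 2 * int q + 2 * int r - 4"
    using assms by (rule delta_set_grid_corner)
  finally show "k \<le> 2 * q + 2 * r - 4" by linarith
qed

end
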